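(* Let $k \geq 2$ and $r \geq 2$ be integers, and let $\delta_{k,r}$ be a number satisfying both $$4(k+1)e^{-\frac{\delta_{k,r}}{3k^2(k+1)}}\leq 1 \qquad\text{and}\qquad 8(k+1)(r-1)e^{-\frac{\delta_{k,r}}{3k^2(k+1)}}\delta_{k,r}\leq 1.$$ Then every hypergraph of rank $r$ with minimum degree at least $\delta_{k,r}$ has a $\frac{1}{k}$-majority $(k+1)$-edge-colouring.
   Context: A hypergraph $G=(V,E)$ consists of a finite vertex set $V$ and a collection $E$ of non-empty subsets of $V$ (hyperedges). The degree $d(v)$ of $v\in V$ is the number of hyperedges containing $v$; the minimum degree is $\delta(G)=\min_{v\in V} d(v)$; the rank of $G$ is $r=\max_{e\in E}|e|$. For an integer $k\geq 2$, a $\frac{1}{k}$-majority $(k+1)$-edge-colouring of $G$ is a map $c:E\to\{1,\dots,k+1\}$ such that for every vertex $v$ and every colour $i$, the number of hyperedges $e\ni v$ with $c(e)=i$ is at most $\lfloor d(v)/k\rfloor$. *)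

theory Defs
  imports Complex_Main
begin

definition hypergraph :: "'a set \<Rightarrow> 'a set set \<Rightarrow> bool" where
  "hypergraph V E \<longleftrightarrow> finite V \<and> E \<subseteq> Pow V \<and> {} \<notin> E"

definition vertex_degree :: "'a set set \<Rightarrow> 'a \<Rightarrow> nat" where
  "vertex_degree E v = card {e \<in> E. v \<in> e}"

definition min_vertex_degree :: "'a set \<Rightarrow> 'a set set \<Rightarrow> nat" where
  "min_vertex_degree V E = Min (vertex_degree E ` V)"

definition hypergraph_rank :: "'a set set \<Rightarrow> nat" where
  "hypergraph_rank E = Max (card ` E)"

text \<open>
  A \<open>1/k\<close>-majority \<open>(k+1)\<close>-edge-colouring; \<open>div\<close> on natural numbers is the floor of the quotient.
\<close>

definition majority_edge_colouring ::
    "nat \<Rightarrow> 'a set \<Rightarrow> 'a set set \<Rightarrow> ('a set \<Rightarrow> nat) \<Rightarrow> bool" where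
  "majority_edge_colouring k V E c \<longleftrightarrow>
     c ` E \<subseteq> {1..k+1} \<and>
     (\<forall>v\<in>V. \<forall>i\<in>{1..k+1}. card {e \<in> E. v \<in> e \<and> c e = i} \<le> vertex_degree E v div k)"

end

theory Submission
  imports Defs "HOL-Library.FuncSet"
begin

text \<open>
  Colour the hyperedges uniformly at random. For a vertex \<open>v\<close> of degree \<open>d\<close>, the Chernoff bound
  and the union bound over the colours bound the probability that \<open>v\<close> is violated by
  \<open>q v = (k + 1) exp (- d / (3 k\<^sup>2 (k + 1)))\<close>. This event is independent of the violation of
  vertices sharing no hyperedge with \<open>v\<close>. At most \<open>d (r - 1)\<close> other vertices share one, but their
  degrees vary, so the asymmetric local lemma is applied with weights \<open>x v = 2 powr (d / \<delta>) * q v\<close>.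
  As \<open>x v \<le> 2 p\<close> with \<open>p = (k + 1) exp (- \<delta> / (3 k\<^sup>2 (k + 1)))\<close>, the weights of the neighbours
  of \<open>v\<close> sum to at most \<open>d / (4 \<delta>)\<close>, which the factor \<open>2 powr (d / \<delta>)\<close> absorbs.
  All probabilities are expressed by counting colourings.
\<close>

section \<open>The asymmetric local lemma in counting form\<close>

text \<open>
  In the hypothesis \<open>indep\<close>, \<open>q v\<close> bounds the conditional probability of \<open>A v\<close> given that no
  non-neighbouring event occurs; this replaces the independence assumption of the local lemma.
\<close>

lemma lovasz_local_counting:
  fixes A :: "'i \<Rightarrow> 'w set" and x q :: "'i \<Rightarrow> real"
  assumes fin: "finite \<Omega>" "finite I" and ne: "\<Omega> \<noteq> {}"
    and x: "\<And>v. v \<in> I \<Longrightarrow> 0 \<le> x v \<and> x v < 1"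
    and nbr: "\<And>v. v \<in> I \<Longrightarrow> \<Gamma> v \<subseteq> I"
    and indep: "\<And>v S. v \<in> I \<Longrightarrow> S \<subseteq> I - insert v (\<Gamma> v) \<Longrightarrow>
      real (card (A v \<inter> (\<Omega> - \<Union>(A ` S)))) \<le> q v * real (card (\<Omega> - \<Union>(A ` S)))"
    and q: "\<And>v. v \<in> I \<Longrightarrow> q v \<le> x v * (\<Prod>u\<in>\<Gamma> v. 1 - x u)"
  shows "\<exists>\<omega>\<in>\<Omega>. \<forall>v\<in>I. \<omega> \<notin> A v"
proof -
  define good where "good S = \<Omega> - \<Union>(A ` S)" for S
  have fin_good: "finite (good S)" for S
    using fin by (simp add: good_def)
  have step: "(1 - x u) * card (good T) \<le> card (good (insert u T))"
    if "real (card (A u \<inter> good T)) \<le> x u * card (good T)" for u T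
  proof -
    have "good (insert u T) = good T - A u \<inter> good T"
      by (auto simp: good_def)
    then have "card (good (insert u T)) = card (good T) - card (A u \<inter> good T)"
      using fin_good by (simp add: card_Diff_subset)
    moreover have "card (A u \<inter> good T) \<le> card (good T)"
      using fin_good by (intro card_mono) auto
    ultimately show ?thesis
      using that by (simp add: algebra_simps of_nat_diff)
  qed
  \<comment> \<open>The events of \<open>U\<close> are excluded one at a time, each costing a factor
    \<open>1 - x u\<close>. The bound is assumed only for proper subsets \<open>W\<close> of
    \<open>U\<close>, so that an induction on the size of the conditioning set can supply
    it.\<close>
  have chain: "(\<Prod>u\<in>U. 1 - x u) * card (good T) \<le> card (good (U \<union> T))"
    if "finite U" "U \<subseteq> I"
      and "\<And>u W. u \<in> U \<Longrightarrow> W \<subset> U \<Longrightarrow> u \<notin> W \<Longrightarrow>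
        real (card (A u \<inter> good (W \<union> T))) \<le> x u * card (good (W \<union> T))" for U T
    using that
  proof (induction U rule: finite_induct)
    case (insert u U)
    have "(\<Prod>w\<in>U. 1 - x w) * card (good T) \<le> card (good (U \<union> T))"
    proof (rule insert.IH)
      show "real (card (A w \<inter> good (W \<union> T))) \<le> x w * card (good (W \<union> T))"
        if "w \<in> U" "W \<subset> U" "w \<notin> W" for w W
        using that by (intro insert.prems) auto
    qed (use insert.prems in auto)
    then have "(1 - x u) * ((\<Prod>w\<in>U. 1 - x w) * card (good T)) \<le> (1 - x u) * card (good (U \<union> T))"
      using x[of u] insert.prems(1) by (intro mult_left_mono) auto
    also have "\<dots> \<le> card (good (insert u (U \<union> T)))"
      using insert.hyps by (intro step insert.prems) auto
    finally show ?case
      using insert.hyps by (simp add: mult.assoc)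
  qed simp
  \<comment> \<open>The central claim: given that no event of \<open>S\<close> occurs,
    \<open>A v\<close> has probability at most \<open>x v\<close>. In product form it also covers an
    empty \<open>good S\<close>.\<close>
  have key: "real (card (A v \<inter> good S)) \<le> x v * card (good S)"
    if "v \<in> I" "S \<subseteq> I - {v}" for v S
    using that
  proof (induction "card S" arbitrary: v S rule: less_induct)
    case less
    have finS: "finite S"
      using less.prems fin(2) by (auto intro: finite_subset)
    define S1 S2 where "S1 = S \<inter> \<Gamma> v" and "S2 = S - \<Gamma> v"
    have S: "S = S1 \<union> S2"
      by (auto simp: S1_def S2_def)
    have fins: "finite (\<Gamma> v)"
      using nbr[OF less.prems(1)] fin(2) by (rule finite_subset)
    \<comment> \<open>Dropping the neighbours \<open>S1\<close> from the condition enlarges the set,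
      after which \<open>indep\<close> applies. The passage from \<open>good S2\<close> back to
      \<open>good S\<close> is paid for by the product over \<open>S1\<close>, through
      \<open>chain\<close>.\<close>
    have "real (card (A v \<inter> good S)) \<le> card (A v \<inter> good S2)"
      using fin_good by (intro of_nat_mono card_mono) (auto simp: good_def S)
    also have "\<dots> \<le> q v * card (good S2)"
      unfolding good_def using less.prems by (intro indep) (auto simp: S2_def)
    also have "\<dots> \<le> (x v * (\<Prod>u\<in>\<Gamma> v. 1 - x u)) * card (good S2)"
      using q[OF less.prems(1)] by (intro mult_right_mono) auto
    also have "\<dots> \<le> (x v * (\<Prod>u\<in>S1. 1 - x u)) * card (good S2)"
    proof (intro mult_right_mono mult_left_mono)
      have 01: "0 \<le> 1 - x u \<and> 1 - x u \<le> 1" if "u \<in> \<Gamma> v" for u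
        using x[of u] nbr[OF less.prems(1)] that by auto
      have "(\<Prod>u\<in>\<Gamma> v. 1 - x u) = (\<Prod>u\<in>\<Gamma> v - S1. 1 - x u) * (\<Prod>u\<in>S1. 1 - x u)"
        using fins by (intro prod.subset_diff) (auto simp: S1_def)
      also have "\<dots> \<le> 1 * (\<Prod>u\<in>S1. 1 - x u)"
        using 01 by (intro mult_right_mono prod_le_1 prod_nonneg) (auto simp: S1_def)
      finally show "(\<Prod>u\<in>\<Gamma> v. 1 - x u) \<le> (\<Prod>u\<in>S1. 1 - x u)"
        by simp
    qed (use x less.prems in auto)
    also have "\<dots> \<le> x v * card (good S)"
    proof -
      have "(\<Prod>u\<in>S1. 1 - x u) * card (good S2) \<le> card (good (S1 \<union> S2))"
      proof (rule chain)
        show "real (card (A u \<inter> good (W \<union> S2))) \<le> x u * card (good (W \<union> S2))"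
          if "u \<in> S1" "W \<subset> S1" "u \<notin> W" for u W
        proof (rule less.hyps)
          have "W \<union> S2 \<subset> S"
            using that by (auto simp: S1_def S2_def)
          then show "card (W \<union> S2) < card S"
            using finS by (rule psubset_card_mono[rotated])
          show "u \<in> I" "W \<union> S2 \<subseteq> I - {u}"
            using that less.prems by (auto simp: S1_def S2_def)
        qed
      qed (use finS less.prems in \<open>auto simp: S1_def\<close>)
      then have "x v * ((\<Prod>u\<in>S1. 1 - x u) * card (good S2)) \<le> x v * card (good S)"
        using x less.prems(1) unfolding S by (intro mult_left_mono) auto
      then show ?thesis
        by (simp add: mult.assoc)
    qed
    finally show ?case .
  qed
  have "0 < (\<Prod>u\<in>I. 1 - x u) * card (good {})"
    using x fin ne by (intro mult_pos_pos prod_pos) (auto simp: good_def card_gt_0_iff)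
  also have "\<dots> \<le> card (good (I \<union> {}))"
    using fin(2) by (intro chain key) auto
  finally have "good I \<noteq> {}"
    by (metis card.empty of_nat_0 order_less_irrefl Un_empty_right)
  then show ?thesis
    by (auto simp: good_def)
qed

section \<open>The Chernoff bound by counting colourings\<close>

text \<open>A function on a disjoint union is the same as a pair of functions on the two parts. This
  is the independence of the colours on \<open>B\<close> and on \<open>C\<close>.\<close>

lemma sum_PiE_Un_disjoint:
  fixes F G :: "('a \<Rightarrow> 'b) \<Rightarrow> real"
  assumes "B \<inter> C = {}"
  shows "(\<Sum>\<omega>\<in>PiE (B \<union> C) K. F (restrict \<omega> B) * G (restrict \<omega> C)) = (\<Sum>b\<in>PiE B K. F b) * (\<Sum>c\<in>PiE C K. G c)"
proof -
  have "(\<Sum>\<omega>\<in>PiE (B \<union> C) K. F (restrict \<omega> B) * G (restrict \<omega> C)) =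
      (\<Sum>(b, c)\<in>PiE B K \<times> PiE C K. F b * G c)"
  proof (rule sum.reindex_bij_witness[where
      i = "\<lambda>(b, c). restrict (\<lambda>e. if e \<in> B then b e else c e) (B \<union> C)"
      and j = "\<lambda>\<omega>. (restrict \<omega> B, restrict \<omega> C)"], goal_cases)
    case (1 \<omega>)
    then show ?case
      by (auto simp: fun_eq_iff PiE_iff extensional_def)
  next
    case (3 bc)
    obtain b c where bc: "bc = (b, c)" "b \<in> PiE B K" "c \<in> PiE C K"
      using 3 by auto
    have "restrict (restrict (\<lambda>e. if e \<in> B then b e else c e) (B \<union> C)) B = b"
      "restrict (restrict (\<lambda>e. if e \<in> B then b e else c e) (B \<union> C)) C = c"
      using bc assms by (auto simp: fun_eq_iff PiE_iff extensional_def restrict_def)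
    then show ?case
      by (simp add: bc)
  qed (use assms in \<open>auto simp: PiE_iff split: if_splits\<close>)
  then show ?thesis
    by (simp add: sum_product sum.cartesian_product)
qed

text \<open>The difference of the two sides vanishes at \<open>0\<close> and has derivative
  \<open>t\<^sup>2 / ((1 + t) * (2 + t)\<^sup>2)\<close>.\<close>

lemma ln_one_plus_lower_bound:
  fixes x :: real
  assumes "0 \<le> x"
  shows "2 * x / (2 + x) \<le> ln (1 + x)"
proof -
  have "ln (1 + 0) - 2 * 0 / (2 + 0) \<le> ln (1 + x) - 2 * x / (2 + x)"
  proof (rule DERIV_nonneg_imp_nondecreasing[OF assms])
    fix t :: real assume t: "0 \<le> t" "t \<le> x"
    have "((\<lambda>x. ln (1 + x) - 2 * x / (2 + x)) has_real_derivative
        (1 / (1 + t) - 4 / (2 + t)\<^sup>2)) (at t)"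
      using t by (auto intro!: derivative_eq_intros simp: power2_eq_square field_simps)
    moreover have "1 / (1 + t) - 4 / (2 + t)\<^sup>2 \<ge> 0"
      using t by (simp add: divide_simps) (simp add: power2_eq_square algebra_simps)
    ultimately show "\<exists>y. ((\<lambda>x. ln (1 + x) - 2 * x / (2 + x)) has_real_derivative y) (at t) \<and> 0 \<le> y"
      by blast
  qed
  then show ?thesis
    by simp
qed

text \<open>Bounding the logarithm below by \<open>2 / (2 * k + 1)\<close> reduces the claim to
  \<open>2 * k + 1 \<le> 3 * k\<close>, that is, \<open>1 \<le> k\<close>. The constant 3 in the
  exponent comes from here.\<close>

lemma chernoff_exponent:
  fixes k :: real
  assumes "1 \<le> k"
  shows "1 / (k * (k + 1)) - ln (1 + 1 / k) / k \<le> - 1 / (3 * k\<^sup>2 * (k + 1))"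
proof -
  have "1 / (k * (k + 1)) + 1 / (3 * k\<^sup>2 * (k + 1)) \<le> (2 * (1 / k) / (2 + 1 / k)) / k"
    using assms by (simp add: divide_simps) (simp add: power2_eq_square algebra_simps)
  also have "\<dots> \<le> ln (1 + 1 / k) / k"
    using assms by (intro divide_right_mono ln_one_plus_lower_bound) auto
  finally show ?thesis
    by simp
qed

text \<open>Markov's inequality for the exponential weight \<open>w\<close>. Since \<open>Q\<close>
  looks only at colours outside \<open>B\<close>, conditioning on it contributes the same factor
  \<open>N\<close> to both sides.\<close>

lemma chernoff_counting:
  fixes Q :: "('a \<Rightarrow> nat) \<Rightarrow> bool"
  assumes k: "k \<ge> 1" and E: "finite E" "B \<subseteq> E" and i: "i \<in> {1..k+1}"
    and Q: "\<And>\<omega>. Q (restrict \<omega> (E - B)) = Q \<omega>"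
  shows "real (card {\<omega> \<in> E \<rightarrow>\<^sub>E {1..k+1}. card B div k < card {e \<in> B. \<omega> e = i} \<and> Q \<omega>})
    \<le> exp (- real (card B) / (3 * (real k)\<^sup>2 * (real k + 1))) * card {\<omega> \<in> E \<rightarrow>\<^sub>E {1..k+1}. Q \<omega>}"
proof -
  define d where "d = card B"
  \<comment> \<open>The mean number of hyperedges of colour \<open>i\<close> in \<open>B\<close> is
    \<open>d / (k + 1)\<close>, and the threshold \<open>d / k\<close> is \<open>1 + 1 / k\<close>
    times this mean. That ratio is the usual Chernoff choice of base.\<close>
  define s where "s = 1 + 1 / real k"
  define w where "w b = (\<Prod>e\<in>B. if b e = i then s else 1)" for b :: "'a \<Rightarrow> nat"
  define N where "N = (\<Sum>c\<in>(E - B) \<rightarrow>\<^sub>E {1..k+1}. of_bool (Q c) :: real)"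
  have s: "s > 1"
    using k by (simp add: s_def)
  have finB: "finite B"
    using E finite_subset by blast
  have EB: "B \<union> (E - B) = E"
    using E by auto
  have fin: "finite (E \<rightarrow>\<^sub>E {1..k+1})"
    using E by (intro finite_PiE) auto
  have w_eq: "w \<omega> = s ^ card {e \<in> B. \<omega> e = i}" for \<omega>
    using finB by (simp add: w_def prod.If_cases Int_def)
  have w_restrict: "w (restrict \<omega> B) = w \<omega>" for \<omega>
    by (simp add: w_def)
  have total: "real (card {\<omega> \<in> E \<rightarrow>\<^sub>E {1..k+1}. Q \<omega>}) = (real k + 1) ^ d * N"
  proof -
    have "real (card {\<omega> \<in> E \<rightarrow>\<^sub>E {1..k+1}. Q \<omega>}) = (\<Sum>\<omega>\<in>E \<rightarrow>\<^sub>E {1..k+1}. 1 * of_bool (Q (restrict \<omega> (E - B))))"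
      using fin by (simp add: Q sum.If_cases of_bool_def Int_def)
    also have "\<dots> = (\<Sum>b\<in>B \<rightarrow>\<^sub>E {1..k+1}. 1) * N"
      using sum_PiE_Un_disjoint[of B "E - B" "\<lambda>_. 1" "\<lambda>c. of_bool (Q c)" "\<lambda>_. {1..k+1}", unfolded EB]
      by (simp add: N_def)
    also have "\<dots> = (real k + 1) ^ d * N"
      using finB by (simp add: card_PiE d_def add_ac)
    finally show ?thesis .
  qed
  have weighted: "(\<Sum>\<omega>\<in>E \<rightarrow>\<^sub>E {1..k+1}. w \<omega> * of_bool (Q \<omega>)) = (real k + s) ^ d * N"
  proof -
    have "(\<Sum>\<omega>\<in>E \<rightarrow>\<^sub>E {1..k+1}. w \<omega> * of_bool (Q \<omega>)) = (\<Sum>b\<in>B \<rightarrow>\<^sub>E {1..k+1}. w b) * N"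
      using sum_PiE_Un_disjoint[of B "E - B" w "\<lambda>c. of_bool (Q c)" "\<lambda>_. {1..k+1}", unfolded EB]
      by (simp add: N_def w_restrict Q)
    also have "(\<Sum>b\<in>B \<rightarrow>\<^sub>E {1..k+1}. w b) = (\<Prod>e\<in>B. \<Sum>j\<in>{1..k+1}. if j = i then s else 1)"
      unfolding w_def using finB by (intro prod_sum_PiE[symmetric]) auto
    also have "(\<Sum>j\<in>{1..k+1}. if j = i then s else 1) = real k + s"
    proof -
      have "(\<Sum>j\<in>{1..k+1}. if j = i then s else 1) = s + (\<Sum>j\<in>{1..k+1} - {i}. if j = i then s else 1)"
        using i by (subst sum.remove[of _ i]) auto
      also have "(\<Sum>j\<in>{1..k+1} - {i}. if j = i then s else 1) = (\<Sum>j\<in>{1..k+1} - {i}. 1)"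
        by (intro sum.cong) auto
      also have "\<dots> = k"
        using i by simp
      finally show ?thesis
        by simp
    qed
    finally show ?thesis
      by (simp add: d_def)
  qed
  define bad where "bad = {\<omega> \<in> E \<rightarrow>\<^sub>E {1..k+1}. d div k < card {e \<in> B. \<omega> e = i} \<and> Q \<omega>}"
  have "card bad * s powr (d / k) = (\<Sum>\<omega>\<in>bad. s powr (d / k))"
    by simp
  also have "\<dots> \<le> (\<Sum>\<omega>\<in>bad. w \<omega> * of_bool (Q \<omega>))"
  proof (rule sum_mono)
    fix \<omega> assume \<omega>: "\<omega> \<in> bad"
    \<comment> \<open>Exceeding the floor of \<open>d / k\<close> by an integer count means
      exceeding \<open>d / k\<close> itself, so rounding loses nothing.\<close>
    have "d < k * card {e \<in> B. \<omega> e = i}"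
      using \<omega> k by (simp add: bad_def div_less_iff_less_mult mult.commute)
    then have "real d / k \<le> card {e \<in> B. \<omega> e = i}"
      using k by (simp add: divide_le_eq mult.commute flip: of_nat_mult)
    then have "s powr (d / k) \<le> s powr card {e \<in> B. \<omega> e = i}"
      using s by (intro powr_mono) auto
    then show "s powr (d / k) \<le> w \<omega> * of_bool (Q \<omega>)"
      using \<omega> s by (simp add: bad_def w_eq powr_realpow)
  qed
  also have "\<dots> \<le> (\<Sum>\<omega>\<in>E \<rightarrow>\<^sub>E {1..k+1}. w \<omega> * of_bool (Q \<omega>))"
    using fin s by (intro sum_mono2) (auto simp: bad_def w_eq)
  also have "\<dots> = (real k + s) ^ d * N"
    by (rule weighted)
  finally have "card bad \<le> (real k + s) ^ d * N / s powr (d / k)"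
    using s by (simp add: pos_le_divide_eq)
  also have "\<dots> \<le> exp (- real d / (3 * (real k)\<^sup>2 * (real k + 1))) * ((real k + 1) ^ d * N)"
  proof -
    \<comment> \<open>The second factor is the average weight of one hyperedge; it is then bounded
      by \<open>1 + y \<le> exp y\<close>.\<close>
    have "real k + s = (real k + 1) * (1 + 1 / (k * (real k + 1)))"
      using k add_pos_pos[of "real k" "real k * real k"] by (simp add: s_def field_simps)
    also have "\<dots> \<le> (real k + 1) * exp (1 / (k * (real k + 1)))"
      by (intro mult_left_mono exp_ge_add_one_self) auto
    finally have "(real k + s) ^ d \<le> ((real k + 1) * exp (1 / (k * (real k + 1)))) ^ d"
      using s by (intro power_mono) auto
    also have "\<dots> = (real k + 1) ^ d * exp (d * (1 / (k * (real k + 1))))"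
      by (simp only: power_mult_distrib exp_of_nat_mult)
    finally have "(real k + s) ^ d / s powr (d / k)
        \<le> (real k + 1) ^ d * exp (d * (1 / (k * (real k + 1)))) / s powr (d / k)"
      using s by (intro divide_right_mono) auto
    also have "\<dots> = (real k + 1) ^ d * exp (d * (1 / (k * (real k + 1)) - ln s / k))"
      using s by (simp add: powr_def right_diff_distrib exp_diff)
    also have "\<dots> \<le> (real k + 1) ^ d * exp (d * (- 1 / (3 * (real k)\<^sup>2 * (real k + 1))))"
      unfolding s_def using k
      by (intro mult_left_mono iffD2[OF exp_le_cancel_iff] chernoff_exponent) auto
    finally have "(real k + s) ^ d / s powr (d / k) * N
        \<le> (real k + 1) ^ d * exp (d * (- 1 / (3 * (real k)\<^sup>2 * (real k + 1)))) * N"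
      by (intro mult_right_mono) (auto simp: N_def intro: sum_nonneg)
    then show ?thesis
      by (simp add: mult_ac)
  qed
  finally show ?thesis
    unfolding total by (simp add: bad_def d_def)
qed

section \<open>Choice of weights and application to hypergraphs\<close>

text \<open>Turns the product in the local lemma into the exponential of a sum of weights. It
  follows from \<open>ln (1 - x) \<ge> - x - 2 * x\<^sup>2\<close>, where
  \<open>2 * x\<^sup>2 \<le> x\<close> on this range.\<close>

lemma one_minus_ge_exp:
  fixes x :: real
  assumes "0 \<le> x" "x \<le> 1 / 2"
  shows "exp (- 2 * x) \<le> 1 - x"
proof -
  have "x * x \<le> x * (1 / 2)"
    using assms by (intro mult_left_mono)
  then have "- 2 * x \<le> - x - 2 * x\<^sup>2"
    by (simp add: power2_eq_square)
  also have "\<dots> \<le> ln (1 - x)"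
    using assms by (rule ln_one_minus_pos_lower_bound)
  finally show ?thesis
    using assms by (subst ln_ge_iff[symmetric]) auto
qed

lemma card_neighbours_le:
  assumes "finite E" "\<And>e. e \<in> E \<Longrightarrow> finite e \<and> card e \<le> r"
  shows "card (\<Union>{e \<in> E. v \<in> e} - {v}) \<le> vertex_degree E v * (r - 1)"
proof -
  have "\<Union>{e \<in> E. v \<in> e} - {v} = (\<Union>e\<in>{e \<in> E. v \<in> e}. e - {v})"
    by auto
  also have "card \<dots> \<le> (\<Sum>e\<in>{e \<in> E. v \<in> e}. card (e - {v}))"
    using assms by (intro card_UN_le) auto
  also have "\<dots> \<le> (\<Sum>e\<in>{e \<in> E. v \<in> e}. r - 1)"
    using assms by (intro sum_mono) (auto simp: diff_le_mono)
  finally show ?thesis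
    by (simp add: vertex_degree_def)
qed

theorem theorem1:
  fixes k r :: nat and \<delta> :: real and V :: "'a set" and E :: "'a set set"
  assumes "k \<ge> 2" and "r \<ge> 2"
    and "4 * (real k + 1) * exp (- \<delta> / (3 * (real k)\<^sup>2 * (real k + 1))) \<le> 1"
    and "8 * (real k + 1) * (real r - 1) * exp (- \<delta> / (3 * (real k)\<^sup>2 * (real k + 1))) * \<delta> \<le> 1"
    and "hypergraph V E" and "hypergraph_rank E = r" and "\<delta> \<le> real (min_vertex_degree V E)"
  shows "\<exists>c. majority_edge_colouring k V E c"
proof -
  define D where "D = 3 * (real k)\<^sup>2 * (real k + 1)"
  define p where "p = (real k + 1) * exp (- \<delta> / D)"
  define deg where "deg = vertex_degree E"
  define t where "t v = deg v / \<delta>" for v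
  define q where "q v = (real k + 1) * exp (- real (deg v) / D)" for v
  define x where "x v = 2 powr t v * q v" for v
  define inc where "inc v = {e \<in> E. v \<in> e}" for v
  define \<Gamma> where "\<Gamma> v = \<Union>(inc v) - {v}" for v
  define A where "A v = {c. \<exists>i\<in>{1..k+1}. deg v div k < card {e \<in> inc v. c e = i}}" for v
  have D: "D > 0"
    using assms(1) by (simp add: D_def)
  have p: "4 * p \<le> 1" "8 * p * (real r - 1) * \<delta> \<le> 1"
    using assms(3,4) unfolding p_def D_def by (simp_all only: mult_ac)
  have p0: "p > 0"
    by (simp add: p_def)
  have finV: "finite V" and EV: "E \<subseteq> Pow V"
    using assms(5) by (auto simp: hypergraph_def)
  then have finE: "finite E"
    by (meson finite_Pow_iff finite_subset)
  have deg_inc: "deg v = card (inc v)" for v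
    by (simp add: deg_def inc_def vertex_degree_def)
  have card_e: "finite e \<and> card e \<le> r" if "e \<in> E" for e
    using that EV finV finE assms(6) by (auto simp: hypergraph_rank_def intro: finite_subset)
  \<comment> \<open>Positivity is forced by the first numerical hypothesis: otherwise
    \<open>p\<close> would be at least \<open>k + 1\<close>.\<close>
  have \<delta>: "\<delta> > 0"
  proof (rule ccontr)
    assume "\<not> \<delta> > 0"
    then have "1 \<le> exp (- \<delta> / D)"
      using D by (simp add: divide_nonpos_pos)
    then have "p \<ge> real k + 1"
      unfolding p_def by simp
    with p(1) show False
      by simp
  qed
  have t1: "t v \<ge> 1" if "v \<in> V" for v
  proof -
    have "min_vertex_degree V E \<le> deg v"
      using that finV by (simp add: min_vertex_degree_def deg_def)
    then show ?thesis
      using assms(7) \<delta> by (simp add: t_def)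
  qed
  have x: "0 \<le> x v" "x v \<le> 2 * p" if "v \<in> V" for v
  proof -
    have "2 * exp (- \<delta> / D) \<le> 2 * p"
      unfolding p_def by simp
    then have le1: "2 * exp (- \<delta> / D) \<le> 1"
      using p(1) by linarith
    \<comment> \<open>As \<open>deg v = t v * \<delta>\<close>, both factors are powers with
      exponent \<open>t v\<close>. The common base is at most 1, so the value is largest at
      \<open>t v = 1\<close>.\<close>
    have "2 powr t v * exp (- real (deg v) / D) = (2 * exp (- \<delta> / D)) powr t v"
      using \<delta> by (simp add: powr_mult t_def exp_powr_real)
    also have "\<dots> \<le> (2 * exp (- \<delta> / D)) powr 1"
      using le1 t1[OF that] by (intro powr_mono') auto
    finally have "(real k + 1) * (2 powr t v * exp (- real (deg v) / D)) \<le> (real k + 1) * (2 * exp (- \<delta> / D))"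
      by (intro mult_left_mono) auto
    then show "x v \<le> 2 * p"
      by (simp add: x_def q_def p_def mult_ac)
    show "0 \<le> x v"
      by (simp add: x_def q_def)
  qed
  have \<Gamma>V: "\<Gamma> v \<subseteq> V" for v
    using EV by (auto simp: \<Gamma>_def inc_def)
  have sum_x: "(\<Sum>u\<in>\<Gamma> v. x u) \<le> t v / 4" if "v \<in> V" for v
  proof -
    have "(\<Sum>u\<in>\<Gamma> v. x u) \<le> card (\<Gamma> v) * (2 * p)"
      using x \<Gamma>V by (intro sum_bounded_above) auto
    also have "\<dots> \<le> real (deg v * (r - 1)) * (2 * p)"
      using p0 card_neighbours_le[OF finE card_e]
      by (intro mult_right_mono of_nat_mono) (auto simp: \<Gamma>_def inc_def deg_def)
    \<comment> \<open>Here \<open>deg v\<close> is written as \<open>t v * \<delta>\<close>, which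
      isolates the quantity bounded by 1 in the second numerical hypothesis.\<close>
    also have "\<dots> = t v / 4 * (8 * p * (real r - 1) * \<delta>)"
      using \<delta> assms(2) by (simp add: t_def of_nat_diff)
    also have "\<dots> \<le> t v / 4 * 1"
      using p(2) t1[OF that] by (intro mult_left_mono) auto
    finally show ?thesis
      by simp
  qed
  have "\<exists>\<omega>\<in>E \<rightarrow>\<^sub>E {1..k+1}. \<forall>v\<in>V. \<omega> \<notin> A v"
  proof (rule lovasz_local_counting[where \<Gamma> = \<Gamma> and x = x and q = q])
    show "finite (E \<rightarrow>\<^sub>E {1..k+1})"
      using finE by (intro finite_PiE) auto
    show "E \<rightarrow>\<^sub>E {1..k+1} \<noteq> {}"
      by (simp add: PiE_eq_empty_iff)
    show "0 \<le> x v \<and> x v < 1" if "v \<in> V" for v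
      using x[OF that] p by auto
    show "q v \<le> x v * (\<Prod>u\<in>\<Gamma> v. 1 - x u)" if "v \<in> V" for v
    proof -
      \<comment> \<open>The claim amounts to bounding the product below by
        \<open>2 powr (- t v)\<close>, because \<open>q v = x v / 2 powr t v\<close>. It rests on
        \<open>1 / 2 \<le> exp (- 1 / 2)\<close> and on the bound \<open>t v / 4\<close> for the sum
        of weights.\<close>
      have "1 / 2 powr t v = (1 / 2) powr t v"
        by (simp add: powr_divide)
      also have "\<dots> \<le> exp (- (1 / 2)) powr t v"
        using exp_ge_add_one_self[of "- (1 / 2)"] t1[OF that] by (intro powr_mono2) auto
      also have "\<dots> = exp (- 2 * (t v / 4))"
        by (simp add: exp_powr_real)
      also have "\<dots> \<le> exp (- 2 * (\<Sum>u\<in>\<Gamma> v. x u))"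
        using sum_x[OF that] by simp
      also have "\<dots> = (\<Prod>u\<in>\<Gamma> v. exp (- 2 * x u))"
        using finite_subset[OF \<Gamma>V finV] by (simp add: exp_sum sum_distrib_left)
      also have "\<dots> \<le> (\<Prod>u\<in>\<Gamma> v. 1 - x u)"
      proof (intro prod_mono conjI one_minus_ge_exp)
        fix u assume "u \<in> \<Gamma> v"
        then have "u \<in> V"
          using \<Gamma>V by blast
        with x[of u] p(1) show "0 \<le> x u" "x u \<le> 1 / 2"
          by auto
      qed auto
      finally have "x v * (1 / 2 powr t v) \<le> x v * (\<Prod>u\<in>\<Gamma> v. 1 - x u)"
        using x[OF that] by (intro mult_left_mono)
      then show ?thesis
        by (simp add: x_def)
    qed
    show "real (card (A v \<inter> ((E \<rightarrow>\<^sub>E {1..k+1}) - \<Union>(A ` S))))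
        \<le> q v * real (card ((E \<rightarrow>\<^sub>E {1..k+1}) - \<Union>(A ` S)))"
      if "v \<in> V" "S \<subseteq> V - insert v (\<Gamma> v)" for v S
    proof -
      define Q where "Q c \<longleftrightarrow> (\<forall>u\<in>S. c \<notin> A u)" for c
      define bad where "bad i = {c \<in> E \<rightarrow>\<^sub>E {1..k+1}. card (inc v) div k < card {e \<in> inc v. c e = i} \<and> Q c}" for i
      have goodset: "(E \<rightarrow>\<^sub>E {1..k+1}) - \<Union>(A ` S) = {c \<in> E \<rightarrow>\<^sub>E {1..k+1}. Q c}"
        by (auto simp: Q_def)
      \<comment> \<open>No vertex of \<open>S\<close> shares a hyperedge with \<open>v\<close>, so
        the events of \<open>S\<close> are unaffected by the colours on
        \<open>inc v\<close>.\<close>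
      have Q: "Q (restrict c (E - inc v)) = Q c" for c
      proof -
        have "inc u \<subseteq> E - inc v" if "u \<in> S" for u
          using that \<open>S \<subseteq> V - insert v (\<Gamma> v)\<close> by (auto simp: inc_def \<Gamma>_def)
        then have "{e \<in> inc u. restrict c (E - inc v) e = i} = {e \<in> inc u. c e = i}" if "u \<in> S" for u i
          using that by (auto simp: restrict_def split: if_splits)
        then show ?thesis
          unfolding Q_def A_def by (intro ball_cong) auto
      qed
      have "A v \<inter> ((E \<rightarrow>\<^sub>E {1..k+1}) - \<Union>(A ` S)) = (\<Union>i\<in>{1..k+1}. bad i)"
        unfolding goodset by (auto simp: bad_def A_def deg_inc)
      then have "real (card (A v \<inter> ((E \<rightarrow>\<^sub>E {1..k+1}) - \<Union>(A ` S)))) \<le> real (\<Sum>i\<in>{1..k+1}. card (bad i))"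
        by (metis card_UN_le finite_atLeastAtMost of_nat_mono)
      also have "\<dots> = (\<Sum>i\<in>{1..k+1}. real (card (bad i)))"
        by simp
      also have "\<dots> \<le> (\<Sum>i\<in>{1..k+1}. exp (- real (deg v) / D) * card {c \<in> E \<rightarrow>\<^sub>E {1..k+1}. Q c})"
      proof (rule sum_mono)
        fix i assume i: "i \<in> {1..k+1}"
        show "real (card (bad i)) \<le> exp (- real (deg v) / D) * card {c \<in> E \<rightarrow>\<^sub>E {1..k+1}. Q c}"
          unfolding bad_def deg_inc D_def
        proof (rule chernoff_counting)
          show "inc v \<subseteq> E"
            by (auto simp: inc_def)
        qed (use assms(1) finE Q i in auto)
      qed
      also have "\<dots> = q v * card {c \<in> E \<rightarrow>\<^sub>E {1..k+1}. Q c}"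
        by (simp add: q_def add_ac)
      finally show ?thesis
        unfolding goodset .
    qed
  qed (use finV \<Gamma>V in auto)
  then obtain c where c: "c \<in> E \<rightarrow>\<^sub>E {1..k+1}" "\<And>v. v \<in> V \<Longrightarrow> c \<notin> A v"
    by blast
  have "majority_edge_colouring k V E c"
    unfolding majority_edge_colouring_def
  proof (intro conjI ballI)
    show "c ` E \<subseteq> {1..k+1}"
      using c(1) by (auto simp: PiE_iff)
    show "card {e \<in> E. v \<in> e \<and> c e = i} \<le> vertex_degree E v div k"
      if "v \<in> V" "i \<in> {1..k+1}" for v i
      using c(2)[OF that(1)] that(2) by (auto simp: A_def deg_def inc_def not_less conj_assoc)
  qed
  then show ?thesis
    by blast
qed

end
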